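(* Let $p$ be a prime and $q=1/p$. For integers $n\ge1$, $\mu\ge1$, let $P(n,p^\mu)$ be the probability that a random symmetric $n\times n$ matrix over $\mathbf{Z}_{p^\mu}$ has determinant $\not\equiv 0\pmod{p^\mu}$, and extend this by the boundary conditions $P(0,p^\mu)=1$ for $\mu>0$ and $P(n,p^\mu)=0$ for $\mu\le 0$ (all $n\ge0$). Let $\mu>0$. Then for every odd $n\ge 3$, $$P(n,p^\mu)=(1-q^n)P(n-2,p^\mu)+q^nP(n,p^{\mu-2}),$$ and for every odd $n\ge 1$, $$P(n-1,p^\mu)=\frac{P(n,p^\mu)-q^nP(n,p^{\mu-1})}{1-q^n}.$$
   Context: For a positive integer $m$, $\mathbf{Z}_m=\{1,2,\ldots,m\}$ (viewed as residues mod $m$). A random symmetric $n\times n$ matrix over $\mathbf{Z}_m$ is one whose entries $a_{ij}$, $i\le j$, are chosen independently and uniformly from $\mathbf{Z}_m$, with $a_{ji}=a_{ij}$. *)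

theory Defs
  imports Complex_Main "Jordan_Normal_Form.Determinant"
begin

text \<open>Symmetric n x n integer matrices with entries in {0,...,m-1}, i.e. symmetric
  matrices over Z_m (residues represented by their canonical representatives).\<close>
definition sym_mats :: "nat \<Rightarrow> nat \<Rightarrow> int mat set" where
  "sym_mats n m = {A. A \<in> carrier_mat n n \<and> transpose_mat A = A \<and>
      (\<forall>i<n. \<forall>j<n. A $$ (i, j) \<in> {0..<int m})}"

definition prob_nonsing :: "nat \<Rightarrow> nat \<Rightarrow> real" where
  "prob_nonsing n m =
     real (card {A \<in> sym_mats n m. \<not> (int m dvd det A)}) / real (card (sym_mats n m))"

definition P :: "nat \<Rightarrow> nat \<Rightarrow> int \<Rightarrow> real" where
  "P p n \<mu> = (if \<mu> \<le> 0 then 0 else if n = 0 then 1 else prob_nonsing n (p ^ nat \<mu>))"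

end

theory Submission
  imports Defs "HOL-Number_Theory.Cong"
begin

text \<open>
  Write \<open>q = 1/p\<close> and reveal the first row \<open>(a, r)\<close> of the random matrix \<open>A\<close>, with \<open>B\<close> the remaining block.
  If \<open>a\<close> is a unit (probability \<open>1 - q\<close>), the Schur complement of \<open>a\<close> is a uniform symmetric matrix of size
  \<open>n - 1\<close>. If \<open>p\<close> divides \<open>a\<close> but not \<open>r\<close> (probability \<open>q - q ^ n\<close>), a \<open>2 \<times> 2\<close> pivot leaves a uniform
  matrix of size \<open>n - 2\<close>. If \<open>p\<close> divides the whole row and \<open>a = p a'\<close> with \<open>a'\<close> a unit
  (probability \<open>q ^ n (1 - q)\<close>), then \<open>det A\<close> is \<open>p\<close> times a unit times the determinant of a uniform matrix of
  size \<open>n - 1\<close>. If moreover \<open>p\<^sup>2\<close> divides \<open>a\<close> (probability \<open>q ^ (n + 1)\<close>), then \<open>A = D A' D\<close> with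
  \<open>D = diag(p, 1, \<dots>, 1)\<close> and \<open>A'\<close> uniform of size \<open>n\<close>. Hence
  \<open>P(n, \<mu>) = (1 - q) P(n - 1, \<mu>) + (q - q ^ n) P(n - 2, \<mu>) + q ^ n ((1 - q) P(n - 1, \<mu> - 1) + q P(n, \<mu> - 2))\<close>,
  and together with the boundary values this recurrence forces both identities.
\<close>

section \<open>Counting symmetric matrices\<close>

text \<open>Double counting of the pairs \<open>(t, x)\<close> with
  \<open>R (\<phi> (act t x))\<close>: for fixed \<open>t\<close> the map \<open>act t\<close>
  permutes \<open>S\<close>, and for fixed \<open>x\<close> the map sending \<open>t\<close> to
  \<open>\<phi> (act t x)\<close> permutes \<open>T\<close>. In effect, \<open>\<phi>\<close> of a
  uniform element of \<open>S\<close> is uniform on \<open>T\<close>.\<close>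

lemma equal_fibres_card:
  fixes act :: "'t \<Rightarrow> 'a \<Rightarrow> 'a" and \<phi> :: "'a \<Rightarrow> 't"
  assumes S: "finite S" and T: "finite T"
    and act: "\<And>t. t \<in> T \<Longrightarrow> inj_on (act t) S" "\<And>t x. t \<in> T \<Longrightarrow> x \<in> S \<Longrightarrow> act t x \<in> S"
    and orbit: "\<And>x. x \<in> S \<Longrightarrow> inj_on (\<lambda>t. \<phi> (act t x)) T"
      "\<And>t x. t \<in> T \<Longrightarrow> x \<in> S \<Longrightarrow> \<phi> (act t x) \<in> T"
  shows "card {x \<in> S. R (\<phi> x)} * card T = card S * card {t \<in> T. R t}"
proof -
  have card_filter: "card {x \<in> A. Q x} = (\<Sum>x\<in>A. of_bool (Q x))" if "finite A" for A :: "'b set" and Q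
    using that by (simp add: of_bool_def sum.If_cases Int_def)
  have bij1: "bij_betw (act t) S S" if "t \<in> T" for t
    using act that S by (simp add: bij_betw_def endo_inj_surj image_subsetI)
  have bij2: "bij_betw (\<lambda>t. \<phi> (act t x)) T T" if "x \<in> S" for x
    using orbit that T by (simp add: bij_betw_def endo_inj_surj image_subsetI)
  have "card {x \<in> S. R (\<phi> x)} * card T = (\<Sum>t\<in>T. \<Sum>x\<in>S. of_bool (R (\<phi> x)))"
    using S by (simp add: card_filter)
  also have "\<dots> = (\<Sum>t\<in>T. \<Sum>x\<in>S. of_bool (R (\<phi> (act t x))))"
  proof (rule sum.cong[OF refl])
    fix t assume "t \<in> T"
    then show "(\<Sum>x\<in>S. of_bool (R (\<phi> x))) = (\<Sum>x\<in>S. of_bool (R (\<phi> (act t x))))"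
      by (intro sum.reindex_bij_betw[OF bij1, symmetric])
  qed
  also have "\<dots> = (\<Sum>x\<in>S. \<Sum>t\<in>T. of_bool (R (\<phi> (act t x))))"
    by (rule sum.swap)
  also have "\<dots> = (\<Sum>x\<in>S. \<Sum>t\<in>T. of_bool (R t))"
  proof (rule sum.cong[OF refl])
    fix x assume "x \<in> S"
    then show "(\<Sum>t\<in>T. of_bool (R (\<phi> (act t x)))) = (\<Sum>t\<in>T. of_bool (R t))"
      by (intro sum.reindex_bij_betw[OF bij2])
  qed
  also have "\<dots> = card S * card {t \<in> T. R t}"
    using T by (simp add: card_filter)
  finally show ?thesis .
qed

lemma sym_mats_index:
  assumes "A \<in> sym_mats n m" "i < n" "j < n"
  shows "A $$ (i, j) = A $$ (j, i)" "0 \<le> A $$ (i, j)" "A $$ (i, j) < int m"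
proof -
  have "A $$ (i, j) = transpose_mat A $$ (i, j)" "A \<in> carrier_mat n n"
    using assms by (auto simp: sym_mats_def)
  then show "A $$ (i, j) = A $$ (j, i)" using assms by simp
qed (use assms in \<open>auto simp: sym_mats_def\<close>)

lemma sym_mats_carrier: "A \<in> sym_mats n m \<Longrightarrow> A \<in> carrier_mat n n"
  by (simp add: sym_mats_def)

lemma sym_matsI:
  assumes "\<And>i j. i < n \<Longrightarrow> j < n \<Longrightarrow> f i j = f j i"
    and "\<And>i j. i < n \<Longrightarrow> j < n \<Longrightarrow> 0 \<le> f i j \<and> f i j < int m"
  shows "mat n n (\<lambda>(i, j). f i j) \<in> sym_mats n m"
  using assms by (auto simp: sym_mats_def intro!: eq_matI)

text \<open>The upper triangle gives free coordinates on symmetric matrices. Since \<open>Q\<close>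
  constrains each entry separately, the matrices that satisfy it form a product set, and counting
  them reduces to \<open>card_PiE\<close>.\<close>

lemma bij_betw_sym_mats:
  "bij_betw (\<lambda>g. mat n n (\<lambda>(i, j). g (min i j, max i j)))
     (PiE {(i, j). i \<le> j \<and> j < n} (\<lambda>ij. {x \<in> {0..<int m}. Q ij x}))
     {A \<in> sym_mats n m. \<forall>i j. i \<le> j \<longrightarrow> j < n \<longrightarrow> Q (i, j) (A $$ (i, j))}"
    (is "bij_betw ?f ?X ?Y")
proof (rule bij_betwI[where g = "\<lambda>A. restrict (\<lambda>ij. A $$ ij) {(i, j). i \<le> j \<and> j < n}"])
  show "?f \<in> ?X \<rightarrow> ?Y"
  proof
    fix g assume g: "g \<in> ?X"
    have gv: "g (i, j) \<in> {x \<in> {0..<int m}. Q (i, j) x}" if "i \<le> j" "j < n" for i j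
      using PiE_mem[OF g, of "(i, j)"] that by simp
    have "?f g \<in> sym_mats n m"
    proof (rule sym_matsI)
      fix i j assume "i < n" "j < n"
      then show "0 \<le> g (min i j, max i j) \<and> g (min i j, max i j) < int m"
        using gv[of "min i j" "max i j"] by auto
    qed (simp add: min.commute max.commute)
    moreover have "Q (i, j) (?f g $$ (i, j))" if "i \<le> j" "j < n" for i j
      using gv[OF that] that by (simp add: min_def max_def)
    ultimately show "?f g \<in> ?Y" by blast
  qed
  show "(\<lambda>A. restrict (\<lambda>ij. A $$ ij) {(i, j). i \<le> j \<and> j < n}) \<in> ?Y \<rightarrow> ?X"
    by (auto simp: sym_mats_index split: if_splits)
  show "restrict (\<lambda>ij. ?f g $$ ij) {(i, j). i \<le> j \<and> j < n} = g" if g: "g \<in> ?X" for g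
  proof (rule ext)
    fix ij show "restrict (\<lambda>ij. ?f g $$ ij) {(i, j). i \<le> j \<and> j < n} ij = g ij"
      using PiE_arb[OF g, of ij] by (cases ij) (auto simp: restrict_def min_def max_def)
  qed
  show "?f (restrict (\<lambda>ij. A $$ ij) {(i, j). i \<le> j \<and> j < n}) = A" if "A \<in> ?Y" for A
  proof (rule eq_matI)
    fix i j assume "i < dim_row A" "j < dim_col A"
    then have "i < n" "j < n" using that by (auto simp: sym_mats_def)
    then show "?f (restrict (\<lambda>ij. A $$ ij) {(i, j). i \<le> j \<and> j < n}) $$ (i, j) = A $$ (i, j)"
      using that sym_mats_index(1)[of A n m i j] by (auto simp: min_def max_def)
  qed (use that in \<open>auto simp: sym_mats_def\<close>)
qed

lemma finite_triangle: "finite {(i, j). i \<le> j \<and> j < (n::nat)}"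
  by (rule finite_subset[of _ "{..<n} \<times> {..<n}"]) auto


lemma finite_sym_mats: "finite (sym_mats n m)"
  using bij_betw_finite[OF bij_betw_sym_mats[of n m "\<lambda>_ _. True"]]
  by (simp add: finite_PiE finite_triangle)

lemma card_sym_mats_restricted:
  "card {A \<in> sym_mats n m. \<forall>i j. i \<le> j \<longrightarrow> j < n \<longrightarrow> Q (i, j) (A $$ (i, j))}
     = (\<Prod>ij\<in>{(i, j). i \<le> j \<and> j < n}. card {x \<in> {0..<int m}. Q ij x})"
  using bij_betw_same_card[OF bij_betw_sym_mats[of n m Q]]
  by (simp add: card_PiE finite_triangle)

lemma card_residues: "card {x. 0 \<le> x \<and> x < int m} = m"
proof -
  have "{x. 0 \<le> x \<and> x < int m} = {0..<int m}" by auto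
  then show ?thesis by simp
qed

lemma card_sym_mats: "card (sym_mats n m) = (\<Prod>ij\<in>{(i, j). i \<le> j \<and> j < n}. m)"
  using card_sym_mats_restricted[of n m "\<lambda>_ _. True"] by (simp add: card_residues)

lemma card_sym_mats_pos: "m > 0 \<Longrightarrow> card (sym_mats n m) > 0"
  by (simp add: card_sym_mats)

lemma card_multiples:
  assumes "e dvd m" "m > 0"
  shows "card {x \<in> {0..<int m}. int e dvd x} * e = m"
proof -
  obtain k where k: "m = e * k" using assms by (elim dvdE)
  have e: "e > 0" using assms k by auto
  have "{x \<in> {0..<int m}. int e dvd x} = (\<lambda>x. int e * int x) ` {0..<k}"
  proof (intro equalityI subsetI)
    fix x assume x: "x \<in> {x \<in> {0..<int m}. int e dvd x}"
    then obtain y where y: "x = int e * y" by (auto elim: dvdE)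
    have "0 \<le> y" "y < int k" using x y k e by (auto simp: zero_le_mult_iff)
    then show "x \<in> (\<lambda>x. int e * int x) ` {0..<k}"
      using y by (intro image_eqI[of _ _ "nat y"]) auto
  qed (use k e in \<open>auto simp flip: of_nat_mult\<close>)
  moreover have "inj_on (\<lambda>x. int e * int x) {0..<k}" using e by (auto simp: inj_on_def)
  ultimately show ?thesis by (simp add: card_image k)
qed

text \<open>The entries of row 0 are independent coordinates, and because \<open>e j\<close> divides
  \<open>m\<close>, exactly the fraction \<open>1 / e j\<close> of the residues are multiples of
  \<open>e j\<close>. All other coordinates contribute the factor 1.\<close>

lemma card_sym_mats_row_multiples:
  assumes N: "N > 0" and m: "m > 0" and e: "\<And>j. j < N \<Longrightarrow> e j dvd m"
  shows "real (card {A \<in> sym_mats N m. \<forall>j<N. int (e j) dvd A $$ (0, j)})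
           = real (card (sym_mats N m)) * (\<Prod>j<N. 1 / real (e j))"
proof -
  let ?I = "{(i, j). i \<le> j \<and> j < N}"
  define Q where "Q = (\<lambda>(i::nat, j) x. i = 0 \<longrightarrow> int (e j) dvd x)"
  have c: "real (card {x \<in> {0..<int m}. Q ij x}) = real m * (if fst ij = 0 then 1 / real (e (snd ij)) else 1)"
    if "ij \<in> ?I" for ij
  proof (cases "fst ij = 0")
    case True
    define j where "j = snd ij"
    have ij: "ij = (0, j)" "j < N" using True that by (auto simp: j_def prod_eq_iff)
    have "e j > 0" using e[OF ij(2)] m by (auto intro: Nat.gr0I)
    moreover have "real (card {x \<in> {0..<int m}. int (e j) dvd x}) * real (e j) = real m"
      using card_multiples[OF e[OF ij(2)] m] by (metis of_nat_mult)
    ultimately show ?thesis by (simp add: ij Q_def field_simps)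
  next
    case False
    then have "{x \<in> {0..<int m}. Q ij x} = {0..<int m}" by (auto simp: Q_def split_beta)
    with False show ?thesis by simp
  qed
  have "{A \<in> sym_mats N m. \<forall>j<N. int (e j) dvd A $$ (0, j)} =
      {A \<in> sym_mats N m. \<forall>i j. i \<le> j \<longrightarrow> j < N \<longrightarrow> Q (i, j) (A $$ (i, j))}"
    by (auto simp: Q_def)
  then have "real (card {A \<in> sym_mats N m. \<forall>j<N. int (e j) dvd A $$ (0, j)})
      = (\<Prod>ij\<in>?I. real (card {x \<in> {0..<int m}. Q ij x}))"
    by (simp add: card_sym_mats_restricted)
  also have "\<dots> = (\<Prod>ij\<in>?I. real m * (if fst ij = 0 then 1 / real (e (snd ij)) else 1))"
    by (rule prod.cong[OF refl c])
  also have "\<dots> = real (card (sym_mats N m)) * (\<Prod>ij\<in>?I. if fst ij = 0 then 1 / real (e (snd ij)) else 1)"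
    by (simp add: prod.distrib card_sym_mats)
  also have "(\<Prod>ij\<in>?I. if fst ij = 0 then 1 / real (e (snd ij)) else 1)
      = (\<Prod>ij\<in>Pair (0::nat) ` {..<N}. if fst ij = 0 then 1 / real (e (snd ij)) else 1)"
    by (rule prod.mono_neutral_right[OF finite_triangle]) auto
  also have "\<dots> = (\<Prod>j<N. 1 / real (e j))"
    by (subst prod.reindex) (auto simp: inj_on_def)
  finally show ?thesis .
qed

lemma cong_det:
  assumes "A \<in> carrier_mat n n" "B \<in> carrier_mat n n"
    and "\<And>i j. i < n \<Longrightarrow> j < n \<Longrightarrow> [A $$ (i, j) = B $$ (i, j)] (mod d)"
  shows "[det A = det B] (mod (d::int))"
  unfolding det_def'[OF assms(1)] det_def'[OF assms(2)]
  by (intro cong_sum cong_mult cong_refl cong_prod assms(3)) (auto dest: permutes_in_image)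

section \<open>Translations modulo m and equidistribution\<close>

text \<open>Addition over the residues mod \<open>m\<close> in canonical representatives. The shift
  \<open>E\<close> is a plain function, so that it can be given by unreduced entries built from a
  smaller matrix.\<close>

definition radd :: "nat \<Rightarrow> nat \<Rightarrow> int mat \<Rightarrow> (nat \<Rightarrow> nat \<Rightarrow> int) \<Rightarrow> int mat" where
  "radd N m A E = mat N N (\<lambda>(i, j). (A $$ (i, j) + E i j) mod int m)"

lemma radd_index [simp]: "i < N \<Longrightarrow> j < N \<Longrightarrow> radd N m A E $$ (i, j) = (A $$ (i, j) + E i j) mod int m"
  by (simp add: radd_def)

lemma radd_sym_mats:
  assumes "A \<in> sym_mats N m" "m > 0" "\<And>i j. i < N \<Longrightarrow> j < N \<Longrightarrow> E i j = E j i"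
  shows "radd N m A E \<in> sym_mats N m"
  unfolding radd_def using assms sym_mats_index[OF assms(1)] by (intro sym_matsI) auto

lemma inj_on_radd: "inj_on (\<lambda>A. radd N m A E) (sym_mats N m)"
proof (rule inj_onI)
  fix A B assume A: "A \<in> sym_mats N m" and B: "B \<in> sym_mats N m"
    and eq: "radd N m A E = radd N m B E"
  show "A = B"
  proof (rule eq_matI)
    fix i j assume "i < dim_row B" "j < dim_col B"
    then have ij: "i < N" "j < N" using sym_mats_carrier[OF B] by auto
    then have "(A $$ (i, j) + E i j) mod int m = (B $$ (i, j) + E i j) mod int m"
      using arg_cong[OF eq, of "\<lambda>M. M $$ (i, j)"] by simp
    then have "A $$ (i, j) mod int m = B $$ (i, j) mod int m"
      by (metis add_diff_cancel_right' mod_diff_left_eq)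
    then show "A $$ (i, j) = B $$ (i, j)"
      using sym_mats_index[OF A ij] sym_mats_index[OF B ij] by simp
  qed (use sym_mats_carrier[OF A] sym_mats_carrier[OF B] in auto)
qed

text \<open>The shifts \<open>A \<mapsto> A + E t\<close> permute \<open>S\<close>, and \<open>\<Psi>\<close> turns them into translations by \<open>u t\<close> with \<open>u\<close> a unit,
  so \<open>\<Psi>\<close> modulo \<open>d\<close> is equidistributed.\<close>
lemma prob_by_shift_equivariance:
  fixes \<Psi> :: "int mat \<Rightarrow> int mat" and u :: "int mat \<Rightarrow> int"
  assumes d: "d > 0" and S: "S \<subseteq> sym_mats N m"
    and closed: "\<And>A t. A \<in> S \<Longrightarrow> t \<in> sym_mats n d \<Longrightarrow> radd N m A (E t) \<in> S"
    and u: "\<And>A. A \<in> S \<Longrightarrow> coprime (u A) (int d)"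
    and \<Psi>_carrier: "\<And>A. A \<in> S \<Longrightarrow> \<Psi> A \<in> carrier_mat n n"
    and \<Psi>_sym: "\<And>A i j. A \<in> S \<Longrightarrow> i < n \<Longrightarrow> j < n \<Longrightarrow> \<Psi> A $$ (i, j) = \<Psi> A $$ (j, i)"
    and shift: "\<And>A t i j. A \<in> S \<Longrightarrow> t \<in> sym_mats n d \<Longrightarrow> i < n \<Longrightarrow> j < n \<Longrightarrow>
      [\<Psi> (radd N m A (E t)) $$ (i, j) = \<Psi> A $$ (i, j) + u A * t $$ (i, j)] (mod int d)"
  shows "real (card {A \<in> S. \<not> int d dvd det (\<Psi> A)}) = real (card S) * prob_nonsing n d"
proof -
  \<comment> \<open>Reducing to canonical representatives lands in \<open>sym_mats n d\<close>, the
    set that also parametrises the shifts, so the double counting applies with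
    \<open>T = sym_mats n d\<close>.\<close>
  define \<phi> where "\<phi> A = mat n n (\<lambda>(i, j). \<Psi> A $$ (i, j) mod int d)" for A
  have \<phi>: "int d dvd det (\<phi> A) \<longleftrightarrow> int d dvd det (\<Psi> A)" if "A \<in> S" for A
  proof (rule cong_dvd_iff, rule cong_det)
    show "\<phi> A \<in> carrier_mat n n" by (simp add: \<phi>_def)
  qed (auto simp: \<phi>_def \<Psi>_carrier that cong_def)
  have "card {A \<in> S. \<not> int d dvd det (\<phi> A)} * card (sym_mats n d)
      = card S * card {t \<in> sym_mats n d. \<not> int d dvd det t}"
  proof (rule equal_fibres_card[where act = "\<lambda>t A. radd N m A (E t)" and R = "\<lambda>t. \<not> int d dvd det t"])
    show "finite S" using S finite_sym_mats by (rule finite_subset)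
    show "inj_on (\<lambda>A. radd N m A (E t)) S" for t
      using inj_on_radd S by (rule inj_on_subset)
    show "\<phi> (radd N m A (E t)) \<in> sym_mats n d" if "t \<in> sym_mats n d" "A \<in> S" for A t
      unfolding \<phi>_def using d \<Psi>_sym closed that by (intro sym_matsI) auto
    \<comment> \<open>Cancelling \<open>\<Psi> A\<close> and the unit \<open>u A\<close> modulo
      \<open>d\<close> recovers \<open>t\<close> modulo \<open>d\<close>, hence \<open>t\<close>
      itself, as its entries are canonical representatives.\<close>
    show "inj_on (\<lambda>t. \<phi> (radd N m A (E t))) (sym_mats n d)" if A: "A \<in> S" for A
    proof (rule inj_onI)
      fix t s assume t: "t \<in> sym_mats n d" and s: "s \<in> sym_mats n d"
        and eq: "\<phi> (radd N m A (E t)) = \<phi> (radd N m A (E s))"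
      show "t = s"
      proof (rule eq_matI)
        fix i j assume "i < dim_row s" "j < dim_col s"
        then have ij: "i < n" "j < n" using sym_mats_carrier[OF s] by auto
        have "[\<Psi> (radd N m A (E t)) $$ (i, j) = \<Psi> (radd N m A (E s)) $$ (i, j)] (mod int d)"
          using arg_cong[OF eq, of "\<lambda>M. M $$ (i, j)"] ij by (simp add: \<phi>_def cong_def)
        then have "[\<Psi> A $$ (i, j) + u A * t $$ (i, j) = \<Psi> A $$ (i, j) + u A * s $$ (i, j)] (mod int d)"
          using shift[OF A t ij] shift[OF A s ij] by (meson cong_sym cong_trans)
        then have "[t $$ (i, j) = s $$ (i, j)] (mod int d)"
          using u[OF A] by (simp add: cong_add_lcancel cong_mult_lcancel)
        then show "t $$ (i, j) = s $$ (i, j)"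
          using sym_mats_index[OF t ij] sym_mats_index[OF s ij] by (simp add: cong_def)
      qed (use sym_mats_carrier[OF t] sym_mats_carrier[OF s] in auto)
    qed
  qed (use closed finite_sym_mats in auto)
  moreover have "{A \<in> S. \<not> int d dvd det (\<phi> A)} = {A \<in> S. \<not> int d dvd det (\<Psi> A)}"
    using \<phi> by auto
  ultimately have "real (card {A \<in> S. \<not> int d dvd det (\<Psi> A)}) * real (card (sym_mats n d))
      = real (card S) * real (card {t \<in> sym_mats n d. \<not> int d dvd det t})"
    by (simp flip: of_nat_mult)
  then show ?thesis
    using card_sym_mats_pos[OF d, of n] by (simp add: prob_nonsing_def field_simps)
qed

section \<open>Schur complements\<close>

text \<open>A division-free form of block elimination, valid over the integers: multiplying from the
  left by the lower triangular block matrix with diagonal blocks \<open>1\<close> and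
  \<open>\<delta>\<close> clears the block \<open>X\<close>. In the applications
  \<open>\<delta>\<close> is \<open>det K\<close>, and \<open>L\<close> is the adjugate of
  \<open>K\<close>.\<close>

lemma det_schur_complement:
  fixes K :: "int mat"
  assumes K: "K \<in> carrier_mat k k" and Y: "Y \<in> carrier_mat k n" and X: "X \<in> carrier_mat n k"
    and C: "C \<in> carrier_mat n n" and L: "L \<in> carrier_mat k k" and LK: "L * K = \<delta> \<cdot>\<^sub>m 1\<^sub>m k"
  shows "\<delta> ^ n * det (four_block_mat K Y X C) = det K * det (\<delta> \<cdot>\<^sub>m C - X * L * Y)"
proof -
  let ?M = "four_block_mat (1\<^sub>m k) (0\<^sub>m k n) (- (X * L)) (\<delta> \<cdot>\<^sub>m 1\<^sub>m n)"
  have XL: "X * L \<in> carrier_mat n k" using X L by simp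
  have "- (X * L) * K = - (X * L * K)" using L K by simp
  also have "X * L * K = X * (\<delta> \<cdot>\<^sub>m 1\<^sub>m k)" using X L K by (simp add: LK[symmetric])
  also have "\<dots> = \<delta> \<cdot>\<^sub>m X" using X by (simp add: mult_smult_distrib[OF X one_carrier_mat])
  finally have b21: "- (X * L) * K + \<delta> \<cdot>\<^sub>m 1\<^sub>m n * X = 0\<^sub>m n k"
    using X by (auto simp: mult_smult_assoc_mat[of _ n n])
  have b22: "- (X * L) * Y + \<delta> \<cdot>\<^sub>m 1\<^sub>m n * C = \<delta> \<cdot>\<^sub>m C - X * L * Y"
    using XL X L Y C by (intro eq_matI) (auto simp: mult_smult_assoc_mat[of _ n n])
  have "?M * four_block_mat K Y X C
      = four_block_mat K Y (0\<^sub>m n k) (\<delta> \<cdot>\<^sub>m C - X * L * Y)"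
    using K Y X C XL
    by (subst mult_four_block_mat[of _ k k _ n _ n _ _ k _ n]) (auto simp: b21 b22)
  moreover have "det (?M * four_block_mat K Y X C) = det ?M * det (four_block_mat K Y X C)"
    using K C by (intro det_mult[of _ "k + n"]) auto
  moreover have "det ?M = \<delta> ^ n"
    using XL by (subst det_four_block_mat_upper_right_zero[of _ k _ n]) auto
  moreover have "det (four_block_mat K Y (0\<^sub>m n k) (\<delta> \<cdot>\<^sub>m C - X * L * Y))
      = det K * det (\<delta> \<cdot>\<^sub>m C - X * L * Y)"
    using mult_carrier_mat[OF XL Y] by (intro det_four_block_mat_lower_left_zero[OF K Y refl] minus_carrier_mat)
  ultimately show ?thesis by simp
qed

lemma transpose_adj_mat:
  assumes "A \<in> carrier_mat n n"
  shows "transpose_mat (adj_mat A) = adj_mat (transpose_mat A)"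
proof (rule eq_matI)
  fix i j assume "i < dim_row (adj_mat (transpose_mat A))" "j < dim_col (adj_mat (transpose_mat A))"
  then have ij: "i < n" "j < n" using assms by (auto simp: adj_mat_def)
  have "mat_delete (transpose_mat A) j i = transpose_mat (mat_delete A i j)"
    using assms by (auto simp: mat_delete_def)
  then have "det (mat_delete (transpose_mat A) j i) = det (mat_delete A i j)"
    using det_transpose[OF mat_delete_carrier[OF assms], of i j] by simp
  then show "transpose_mat (adj_mat A) $$ (i, j) = adj_mat (transpose_mat A) $$ (i, j)"
    using ij assms by (simp add: adj_mat_def cofactor_def add.commute)
qed (use assms in \<open>auto simp: adj_mat_def\<close>)

text \<open>In each Leibniz term the row factors \<open>f i\<close> and the column factors
  \<open>g (\<pi> i)\<close> both run through a full product. This serves to extract powers of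
  \<open>p\<close> from row 0 and column 0.\<close>

lemma det_scale_rows_cols:
  fixes B :: "'a :: comm_ring_1 mat"
  assumes B: "B \<in> carrier_mat n n"
  shows "det (mat n n (\<lambda>(i, j). f i * g j * B $$ (i, j)))
    = (\<Prod>i<n. f i) * (\<Prod>j<n. g j) * det B"
proof -
  let ?A = "mat n n (\<lambda>(i, j). f i * g j * B $$ (i, j))"
  have expand: "(\<Prod>i = 0..<n. ?A $$ (i, \<pi> i))
      = (\<Prod>i<n. f i) * (\<Prod>j<n. g j) * (\<Prod>i = 0..<n. B $$ (i, \<pi> i))"
    if \<pi>: "\<pi> permutes {0..<n}" for \<pi>
  proof -
    have "(\<Prod>i = 0..<n. ?A $$ (i, \<pi> i)) = (\<Prod>i = 0..<n. f i * g (\<pi> i) * B $$ (i, \<pi> i))"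
      using permutes_in_image[OF \<pi>] by (intro prod.cong) auto
    also have "(\<Prod>i = 0..<n. g (\<pi> i)) = (\<Prod>i = 0..<n. g i)"
      using prod.permute[OF \<pi>, of g] by (simp add: o_def)
    then have "(\<Prod>i = 0..<n. f i * g (\<pi> i) * B $$ (i, \<pi> i))
        = (\<Prod>i = 0..<n. f i) * (\<Prod>i = 0..<n. g i) * (\<Prod>i = 0..<n. B $$ (i, \<pi> i))"
      by (simp add: prod.distrib)
    finally show ?thesis by (simp add: atLeast0LessThan)
  qed
  have "det ?A = (\<Sum>\<pi> | \<pi> permutes {0..<n}. signof \<pi> * (\<Prod>i = 0..<n. ?A $$ (i, \<pi> i)))"
    by (rule det_def') simp
  also have "\<dots> = (\<Sum>\<pi> | \<pi> permutes {0..<n}. (\<Prod>i<n. f i) * (\<Prod>j<n. g j) *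
      (signof \<pi> * (\<Prod>i = 0..<n. B $$ (i, \<pi> i))))"
    by (rule sum.cong[OF refl]) (simp only: mem_Collect_eq expand, simp add: ac_simps)
  also have "\<dots> = (\<Prod>i<n. f i) * (\<Prod>j<n. g j) * det B"
    by (simp add: det_def'[OF B] sum_distrib_left)
  finally show ?thesis .
qed

text \<open>Rows and columns each contribute the sign of \<open>\<sigma>\<close>, and its square is
  1.\<close>

lemma det_permute_rows_cols:
  fixes A :: "'a :: comm_ring_1 mat"
  assumes A: "A \<in> carrier_mat n n" and \<sigma>: "\<sigma> permutes {0..<n}"
  shows "det (mat n n (\<lambda>(i, j). A $$ (\<sigma> i, \<sigma> j))) = det A"
proof -
  have lt: "\<sigma> i < n" if "i < n" for i using permutes_in_image[OF \<sigma>, of i] that by simp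
  let ?B = "mat n n (\<lambda>(i, j). A $$ (\<sigma> i, j))"
  let ?C = "mat n n (\<lambda>(i, j). transpose_mat ?B $$ (\<sigma> i, j))"
  have "mat n n (\<lambda>(i, j). A $$ (\<sigma> i, \<sigma> j)) = transpose_mat ?C"
    using lt by (intro eq_matI) auto
  then have "det (mat n n (\<lambda>(i, j). A $$ (\<sigma> i, \<sigma> j))) = det ?C"
    using det_transpose[of ?C n] by simp
  also have "\<dots> = signof \<sigma> * det (transpose_mat ?B)"
    by (rule det_permute_rows[OF _ \<sigma>]) simp
  also have "det (transpose_mat ?B) = det ?B" by (rule det_transpose[of _ n]) simp
  also have "\<dots> = signof \<sigma> * det A" by (rule det_permute_rows[OF A \<sigma>])
  also have "signof \<sigma> * (signof \<sigma> * det A) = det A"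
    by (cases \<sigma> rule: sign_cases) (auto simp: sign_def)
  finally show ?thesis .
qed

section \<open>Conditioning on the first rows\<close>

text \<open>For symmetric matrices this means that everything outside the lower right block
  coincides. A set closed under the relation is an event that depends only on the first
  \<open>k\<close> rows.\<close>

definition rows_agree :: "nat \<Rightarrow> nat \<Rightarrow> int mat \<Rightarrow> int mat \<Rightarrow> bool" where
  "rows_agree k N A B \<longleftrightarrow> (\<forall>i<k. \<forall>j<N. A $$ (i, j) = B $$ (i, j))"

text \<open>Given the first \<open>k\<close> rows, the lower right block is still uniform;
  multiplying it by the unit \<open>\<delta>\<close> and subtracting the fixed symmetric
  \<open>W\<close> keeps it uniform. As \<open>d\<close> divides \<open>m\<close>, this survives
  reduction modulo \<open>d\<close>. The shifts act on the lower right block only.\<close>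

lemma prob_lower_block:
  assumes m: "m > 0" and d: "d > 0" "d dvd m" and S: "S \<subseteq> sym_mats (k + n) m"
    and closed: "\<And>A B. A \<in> S \<Longrightarrow> B \<in> sym_mats (k + n) m \<Longrightarrow> rows_agree k (k + n) A B \<Longrightarrow> B \<in> S"
    and \<delta>: "\<And>A. A \<in> S \<Longrightarrow> coprime (\<delta> A) (int d)"
    and \<delta>_rows: "\<And>A B. A \<in> S \<Longrightarrow> B \<in> S \<Longrightarrow> rows_agree k (k + n) A B \<Longrightarrow> \<delta> A = \<delta> B"
    and W_rows: "\<And>A B i j. A \<in> S \<Longrightarrow> B \<in> S \<Longrightarrow> rows_agree k (k + n) A B \<Longrightarrow>
      i < n \<Longrightarrow> j < n \<Longrightarrow> W A i j = W B i j"
    and W_sym: "\<And>A i j. A \<in> S \<Longrightarrow> i < n \<Longrightarrow> j < n \<Longrightarrow> W A i j = W A j i"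
  shows "real (card {A \<in> S. \<not> int d dvd
      det (mat n n (\<lambda>(i, j). \<delta> A * A $$ (k + i, k + j) - W A i j))}) = real (card S) * prob_nonsing n d"
proof (rule prob_by_shift_equivariance[OF d(1) S, where u = \<delta>
      and E = "\<lambda>t i j. if i < k \<or> j < k then 0 else t $$ (i - k, j - k)"])
  let ?E = "\<lambda>t i j. if i < k \<or> j < k then 0 else t $$ (i - k, j - k)"
  have agree: "rows_agree k (k + n) A (radd (k + n) m A (?E t))"
    if "A \<in> S" for A t
    using S that by (auto simp: rows_agree_def sym_mats_index)
  show closed': "radd (k + n) m A (?E t) \<in> S" if "A \<in> S" "t \<in> sym_mats n d" for A t
  proof (rule closed[OF that(1) _ agree[OF that(1)]], rule radd_sym_mats)
    show "?E t i j = ?E t j i" if "i < k + n" "j < k + n" for i j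
      using sym_mats_index(1)[OF \<open>t \<in> sym_mats n d\<close>, of "i - k" "j - k"] that by auto
  qed (use that S m in auto)
  show "[mat n n (\<lambda>(i, j). \<delta> (radd (k + n) m A (?E t)) * radd (k + n) m A (?E t) $$ (k + i, k + j)
        - W (radd (k + n) m A (?E t)) i j) $$ (i, j)
      = mat n n (\<lambda>(i, j). \<delta> A * A $$ (k + i, k + j) - W A i j) $$ (i, j) + \<delta> A * t $$ (i, j)] (mod int d)"
    if A: "A \<in> S" and t: "t \<in> sym_mats n d" and ij: "i < n" "j < n" for A t i j
  proof -
    have "[(A $$ (k + i, k + j) + t $$ (i, j)) mod int m = A $$ (k + i, k + j) + t $$ (i, j)] (mod int m)"
      by (simp add: cong_def)
    then have "[(A $$ (k + i, k + j) + t $$ (i, j)) mod int m = A $$ (k + i, k + j) + t $$ (i, j)] (mod int d)"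
      using d(2) by (elim cong_dvd_modulus) simp
    then have "[\<delta> A * ((A $$ (k + i, k + j) + t $$ (i, j)) mod int m) - W A i j
        = \<delta> A * (A $$ (k + i, k + j) + t $$ (i, j)) - W A i j] (mod int d)"
      by (intro cong_diff cong_mult cong_refl)
    then show ?thesis
      using ij \<delta>_rows[OF A closed'[OF A t] agree[OF A]] W_rows[OF A closed'[OF A t] agree[OF A] ij]
      by (simp add: algebra_simps)
  qed
  show "mat n n (\<lambda>(i, j). \<delta> A * A $$ (k + i, k + j) - W A i j) $$ (i, j)
      = mat n n (\<lambda>(i, j). \<delta> A * A $$ (k + i, k + j) - W A i j) $$ (j, i)"
    if "A \<in> S" "i < n" "j < n" for A i j
    using that S W_sym sym_mats_index(1)[of A "k + n" m "k + i" "k + j"] by auto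
qed (use \<delta> in auto)

definition corner :: "nat \<Rightarrow> int mat \<Rightarrow> int mat" where
  "corner k A = mat k k (\<lambda>ij. A $$ ij)"

definition upper_right :: "nat \<Rightarrow> nat \<Rightarrow> int mat \<Rightarrow> int mat" where
  "upper_right k n A = mat k n (\<lambda>(i, j). A $$ (i, k + j))"

lemma dvd_det_schur_complement:
  assumes c: "coprime \<delta> (d::int)" and eq: "\<delta> ^ n * x = \<delta> * y"
  shows "d dvd x \<longleftrightarrow> d dvd y"
proof -
  have "d dvd x \<longleftrightarrow> d dvd \<delta> ^ n * x"
    using c by (subst coprime_dvd_mult_right_iff) (auto simp: coprime_commute)
  also have "\<dots> \<longleftrightarrow> d dvd y"
    unfolding eq using c by (subst coprime_dvd_mult_right_iff) (auto simp: coprime_commute)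
  finally show ?thesis .
qed

text \<open>Up to unit factors \<open>det A\<close> is the determinant of the Schur complement of
  the corner, here scaled by \<open>det (corner k A)\<close> so that the adjugate replaces the
  inverse. The correction \<open>W\<close> depends on the first \<open>k\<close> rows only, so the
  Schur complement is uniform.\<close>

lemma prob_unit_pivot_block:
  assumes m: "m > 0" and S: "S \<subseteq> sym_mats (k + n) m"
    and closed: "\<And>A B. A \<in> S \<Longrightarrow> B \<in> sym_mats (k + n) m \<Longrightarrow> rows_agree k (k + n) A B \<Longrightarrow> B \<in> S"
    and unit: "\<And>A. A \<in> S \<Longrightarrow> coprime (det (corner k A)) (int m)"
  shows "real (card {A \<in> S. \<not> int m dvd det A}) = real (card S) * prob_nonsing n m"
proof -
  define W where "W A i j = (transpose_mat (upper_right k n A) * adj_mat (corner k A) * upper_right k n A) $$ (i, j)"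
    for A i j
  have corner: "corner k A \<in> carrier_mat k k" and ur: "upper_right k n A \<in> carrier_mat k n" for A
    by (simp_all add: corner_def upper_right_def)
  have agree: "corner k A = corner k B \<and> upper_right k n A = upper_right k n B"
    if "rows_agree k (k + n) A B" for A B
    using that by (auto simp: rows_agree_def corner_def upper_right_def intro!: eq_matI)
  have "int m dvd det A \<longleftrightarrow>
      int m dvd det (mat n n (\<lambda>(i, j). det (corner k A) * A $$ (k + i, k + j) - W A i j))"
    if A: "A \<in> S" for A
  proof (rule dvd_det_schur_complement[OF unit[OF A], of n])
    let ?C = "mat n n (\<lambda>(i, j). A $$ (k + i, k + j))"
    have A': "A \<in> sym_mats (k + n) m" using A S by auto
    have "A = four_block_mat (corner k A) (upper_right k n A) (transpose_mat (upper_right k n A)) ?C"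
      using sym_mats_carrier[OF A'] sym_mats_index(1)[OF A']
      by (intro eq_matI) (auto simp: corner_def upper_right_def)
    moreover have "mat n n (\<lambda>(i, j). det (corner k A) * A $$ (k + i, k + j) - W A i j)
        = det (corner k A) \<cdot>\<^sub>m ?C - transpose_mat (upper_right k n A) * adj_mat (corner k A) * upper_right k n A"
      using adj_mat(1)[OF corner, of A] ur[of A] by (intro eq_matI) (auto simp: W_def)
    ultimately show "det (corner k A) ^ n * det A
        = det (corner k A) * det (mat n n (\<lambda>(i, j). det (corner k A) * A $$ (k + i, k + j) - W A i j))"
      using det_schur_complement[OF corner[of A] ur[of A], where X = "transpose_mat (upper_right k n A)" and C = ?C,
          OF _ _ adj_mat(1)[OF corner[of A]] adj_mat(3)[OF corner[of A]]]
        ur[of A] by simp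
  qed
  then have "{A \<in> S. \<not> int m dvd det A} = {A \<in> S. \<not> int m dvd
      det (mat n n (\<lambda>(i, j). det (corner k A) * A $$ (k + i, k + j) - W A i j))}"
    by blast
  moreover have "real (card {A \<in> S. \<not> int m dvd
      det (mat n n (\<lambda>(i, j). det (corner k A) * A $$ (k + i, k + j) - W A i j))}) = real (card S) * prob_nonsing n m"
  proof (rule prob_lower_block[OF m m dvd_refl S closed unit])
    fix A i j assume A: "A \<in> S" and ij: "i < n" "j < n"
    let ?Y = "upper_right k n A" and ?L = "adj_mat (corner k A)"
    have A': "A \<in> sym_mats (k + n) m" using A S by auto
    \<comment> \<open>Symmetry of \<open>W\<close> comes from the corner: its adjugate
      \<open>L\<close> is symmetric too, and so is the congruence transform of \<open>L\<close> by
      \<open>Y\<close>.\<close>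
    have "transpose_mat (corner k A) = corner k A"
      using sym_mats_index(1)[OF A'] by (intro eq_matI) (auto simp: corner_def)
    then have L: "?L \<in> carrier_mat k k" "transpose_mat ?L = ?L"
      using adj_mat(1)[OF corner] by (auto simp: transpose_adj_mat[OF corner])
    have "transpose_mat (transpose_mat ?Y * ?L * ?Y) = transpose_mat ?Y * transpose_mat (transpose_mat ?Y * ?L)"
      using L(1) ur[of A] by (intro transpose_mult[of _ n k _ n]) auto
    also have "transpose_mat (transpose_mat ?Y * ?L) = transpose_mat ?L * ?Y"
      using L(1) ur[of A] by (subst transpose_mult[of _ n k _ k]) auto
    also have "transpose_mat ?Y * (transpose_mat ?L * ?Y) = transpose_mat ?Y * ?L * ?Y"
      using L ur[of A] by simp
    finally have "W A i j = transpose_mat (transpose_mat ?Y * ?L * ?Y) $$ (i, j)"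
      by (simp only: W_def)
    then show "W A i j = W A j i"
      using ij ur[of A] by (simp only: W_def index_transpose_mat index_mult_mat carrier_matD)
  qed (use agree in \<open>auto simp: W_def\<close>)
  ultimately show ?thesis by simp
qed

section \<open>Matrices with prescribed first row\<close>

lemma det_mat_2:
  fixes f :: "nat \<times> nat \<Rightarrow> 'a :: comm_ring_1"
  shows "det (mat 2 2 f) = f (0, 0) * f (1, 1) - f (0, 1) * f (1, 0)"
proof -
  have "det (mat 2 2 f) = (\<Sum>j<2. mat 2 2 f $$ (0, j) * cofactor (mat 2 2 f) 0 j)"
    by (rule laplace_expansion_row) auto
  then show ?thesis
    by (simp add: numeral_2_eq_2 cofactor_def mat_delete_def det_single)
qed

context
  fixes p :: nat
  assumes p: "prime p"
begin

lemma coprime_prime_power_iff: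
  assumes "e > 0"
  shows "coprime x (int (p ^ e)) \<longleftrightarrow> \<not> int p dvd x"
proof -
  have "coprime x (int (p ^ e)) \<longleftrightarrow> coprime (int p) x"
    using assms by (simp add: coprime_commute)
  also have "\<dots> \<longleftrightarrow> \<not> int p dvd x"
    using p by (metis coprime_absorb_left not_prime_unit prime_imp_coprime prime_nat_int_transfer)
  finally show ?thesis .
qed

lemma prob_unit_corner:
  fixes n e :: nat
  assumes e: "e > 0"
  defines "S \<equiv> {A \<in> sym_mats (1 + n) (p ^ e). \<not> int p dvd A $$ (0, 0)}"
  shows "real (card {A \<in> S. \<not> int (p ^ e) dvd det A}) = real (card S) * prob_nonsing n (p ^ e)"
proof (rule prob_unit_pivot_block[where k = 1])
  show "p ^ e > 0" using p by (simp add: prime_gt_0_nat)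
  show "coprime (det (corner 1 A)) (int (p ^ e))" if "A \<in> S" for A
    using that e by (simp add: coprime_prime_power_iff S_def corner_def det_single del: of_nat_power)
qed (auto simp: S_def rows_agree_def)

text \<open>Here \<open>j\<close> is the position of the first unit in row 0. Swapping the indices 1
  and \<open>j\<close> in rows and columns keeps symmetry and determinant and moves this unit to
  position \<open>(0, 1)\<close>, where the leading 2 by 2 block becomes an invertible
  pivot.\<close>

lemma prob_unit_off_diagonal:
  fixes n e :: nat
  assumes e: "e > 0" and j: "0 < j" "j < 2 + n"
  defines "S \<equiv> {A \<in> sym_mats (2 + n) (p ^ e). (\<forall>i<j. int p dvd A $$ (0, i)) \<and> \<not> int p dvd A $$ (0, j)}"
  shows "real (card {A \<in> S. \<not> int (p ^ e) dvd det A}) = real (card S) * prob_nonsing n (p ^ e)"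
proof -
  let ?N = "2 + n" and ?m = "p ^ e"
  define \<sigma> where "\<sigma> = Transposition.transpose 1 j"
  define \<rho> where "\<rho> A = mat ?N ?N (\<lambda>(a, b). A $$ (\<sigma> a, \<sigma> b))" for A :: "int mat"
  have \<sigma>: "\<sigma> permutes {0..<?N}" unfolding \<sigma>_def using j by (intro permutes_swap_id) auto
  have lt: "\<sigma> i < ?N" if "i < ?N" for i using permutes_in_image[OF \<sigma>, of i] that by simp
  have \<sigma>0: "\<sigma> 0 = 0" "\<sigma> 1 = j" "\<sigma> j = 1" and \<sigma>\<sigma>: "\<sigma> (\<sigma> i) = i" for i
    using j by (simp_all add: \<sigma>_def transpose_def)
  have \<rho>_sym: "\<rho> A \<in> sym_mats ?N ?m" if A: "A \<in> sym_mats ?N ?m" for A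
    unfolding \<rho>_def using sym_mats_index[OF A lt lt] by (intro sym_matsI) auto
  have \<rho>\<rho>: "\<rho> (\<rho> A) = A" if A: "A \<in> sym_mats ?N ?m" for A
    using sym_mats_carrier[OF A] lt by (intro eq_matI) (auto simp: \<rho>_def \<sigma>\<sigma>)
  have det_\<rho>: "det (\<rho> A) = det A" if A: "A \<in> sym_mats ?N ?m" for A
    unfolding \<rho>_def by (rule det_permute_rows_cols[OF sym_mats_carrier[OF A] \<sigma>])
  have Sub: "S \<subseteq> sym_mats ?N ?m" by (auto simp: S_def)
  have inj: "inj_on \<rho> S" using \<rho>\<rho> Sub by (intro inj_on_inverseI[of _ \<rho>]) auto
  have "real (card {B \<in> \<rho> ` S. \<not> int ?m dvd det B}) = real (card (\<rho> ` S)) * prob_nonsing n ?m"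
  proof (rule prob_unit_pivot_block[where k = 2])
    show "?m > 0" using p by (simp add: prime_gt_0_nat)
    show "\<rho> ` S \<subseteq> sym_mats ?N ?m" using \<rho>_sym Sub by auto
    \<comment> \<open>The minor is a product with the factor \<open>B $$ (0, 0)\<close>, a multiple
      of \<open>p\<close>, minus the square of a unit.\<close>
    show "coprime (det (corner 2 B)) (int ?m)" if "B \<in> \<rho> ` S" for B
    proof -
      from that obtain A where A: "A \<in> S" "B = \<rho> A" by auto
      have B: "B \<in> sym_mats ?N ?m" using A \<rho>_sym Sub by auto
      have "int p dvd A $$ (0, 0)" "\<not> int p dvd A $$ (0, j)" using A j by (auto simp: S_def)
      then have "int p dvd B $$ (0, 0)" "\<not> int p dvd B $$ (0, 1)"
        by (simp_all add: A \<rho>_def \<sigma>0 del: One_nat_def)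
      moreover have "det (corner 2 B) = B $$ (0, 0) * B $$ (1, 1) - B $$ (0, 1) * B $$ (0, 1)"
        using sym_mats_index(1)[OF B, of 1 0] by (simp add: corner_def det_mat_2)
      moreover have "prime (int p)" using p by simp
      ultimately have "\<not> int p dvd det (corner 2 B)"
        by (metis dvd_diff_right_iff dvd_mult2 prime_dvd_multD)
      then show ?thesis using e coprime_prime_power_iff by blast
    qed
    \<comment> \<open>Membership in \<open>S\<close> only involves row 0, and
      \<open>\<sigma>\<close> fixes 0, so row 0 of \<open>B\<close> decides membership in the
      image.\<close>
    show "B \<in> \<rho> ` S" if A': "A' \<in> \<rho> ` S" and B: "B \<in> sym_mats ?N ?m" and agree: "rows_agree 2 ?N A' B" for A' B
    proof -
      obtain A where A: "A \<in> S" "A' = \<rho> A" using A' by auto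
      have "\<rho> B $$ (0, i) = A $$ (0, i)" if "i < ?N" for i
      proof -
        have "\<rho> B $$ (0, i) = A' $$ (0, \<sigma> i)"
          using agree lt[OF that] that by (simp add: \<rho>_def \<sigma>0 rows_agree_def)
        then show ?thesis using lt[OF that] by (simp add: A \<rho>_def \<sigma>0 \<sigma>\<sigma>)
      qed
      then have "\<rho> B \<in> S" using A j \<rho>_sym[OF B] by (simp add: S_def)
      then show ?thesis using \<rho>\<rho>[OF B] by (metis imageI)
    qed
  qed
  moreover have "{B \<in> \<rho> ` S. \<not> int ?m dvd det B} = \<rho> ` {A \<in> S. \<not> int ?m dvd det A}"
    using det_\<rho> Sub by auto
  ultimately show ?thesis
    using card_image[OF inj] card_image[OF inj_on_subset[OF inj], of "{A \<in> S. \<not> int ?m dvd det A}"]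
    by simp
qed

text \<open>Dividing row 0 by \<open>p\<close> turns the corner into the unit \<open>r A 0\<close>
  and lowers the modulus for the determinant from \<open>p ^ e\<close> to
  \<open>p ^ (e - 1)\<close>. The new corner then serves as a 1 by 1 pivot.\<close>

lemma prob_row_multiple_simple_corner:
  fixes n e :: nat
  assumes e: "e \<ge> 2"
  defines "S \<equiv> {A \<in> sym_mats (1 + n) (p ^ e). (\<forall>j<1 + n. int p dvd A $$ (0, j)) \<and> \<not> int p ^ 2 dvd A $$ (0, 0)}"
  shows "real (card {A \<in> S. \<not> int (p ^ e) dvd det A}) = real (card S) * prob_nonsing n (p ^ (e - 1))"
proof -
  let ?N = "1 + n" and ?m = "p ^ e" and ?d = "p ^ (e - 1)"
  define r where "r A j = A $$ (0, j) div int p" for A :: "int mat" and j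
  define W where "W A i j = int p * r A (1 + i) * r A (1 + j)" for A i j
  have p0: "p > 0" using p by (rule prime_gt_0_nat)
  have m: "?m = p * ?d" using e by (cases e) auto
  have row: "A $$ (0, j) = int p * r A j" if "A \<in> S" "j < ?N" for A j
    using that by (simp add: S_def r_def)
  have unit: "coprime (r A 0) (int ?d)" if A: "A \<in> S" for A
  proof -
    have "\<not> int p dvd r A 0"
      using A row[OF A, of 0] p0 by (simp add: S_def power2_eq_square)
    then show ?thesis using e coprime_prime_power_iff[of "e - 1" "r A 0"] by simp
  qed
  have "int ?m dvd det A \<longleftrightarrow>
      int ?d dvd det (mat n n (\<lambda>(i, j). r A 0 * A $$ (1 + i, 1 + j) - W A i j))" if A: "A \<in> S" for A
  proof -
    \<comment> \<open>Only the row is divided, since the corner has just one factor \<open>p\<close>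
      to give. The resulting matrix is not symmetric in general, but its Schur complement is: the
      correction \<open>W\<close> is \<open>p\<close> times a product symmetric in \<open>i\<close>
      and \<open>j\<close>.\<close>
    let ?K = "mat 1 1 (\<lambda>_. r A 0)" and ?Y = "mat 1 n (\<lambda>(i, j). r A (1 + j))"
      and ?X = "mat n 1 (\<lambda>(i, j). int p * r A (1 + i))" and ?C = "mat n n (\<lambda>(i, j). A $$ (1 + i, 1 + j))"
    let ?A1 = "four_block_mat ?K ?Y ?X ?C"
    have A': "A \<in> sym_mats ?N ?m" using A by (auto simp: S_def)
    have A1: "?A1 \<in> carrier_mat ?N ?N" by (intro four_block_carrier_mat) auto
    have "A = mat ?N ?N (\<lambda>(i, j). (if i = 0 then int p else 1) * 1 * ?A1 $$ (i, j))"
      using sym_mats_carrier[OF A'] sym_mats_index(1)[OF A', of _ 0] row[OF A]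
      by (intro eq_matI) auto
    then have "det A = (\<Prod>i<?N. if i = 0 then int p else 1) * (\<Prod>i<?N. 1) * det ?A1"
      using det_scale_rows_cols[OF A1, of "\<lambda>i. if i = 0 then int p else 1" "\<lambda>_. 1"] by simp
    then have "det A = int p * det ?A1" by (simp add: prod.delta)
    then have "int ?m dvd det A \<longleftrightarrow> int ?d dvd det ?A1"
      unfolding m using p0 by simp
    also have "\<dots> \<longleftrightarrow> int ?d dvd det (mat n n (\<lambda>(i, j). r A 0 * A $$ (1 + i, 1 + j) - W A i j))"
    proof (rule dvd_det_schur_complement[OF unit[OF A], of n])
      have "mat n n (\<lambda>(i, j). r A 0 * A $$ (1 + i, 1 + j) - W A i j) = r A 0 \<cdot>\<^sub>m ?C - ?X * 1\<^sub>m 1 * ?Y"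
        by (intro eq_matI) (auto simp: W_def scalar_prod_def)
      moreover have "det ?K = r A 0" by (simp add: det_single)
      moreover have "1\<^sub>m 1 * ?K = r A 0 \<cdot>\<^sub>m 1\<^sub>m 1" by (intro eq_matI) auto
      ultimately show "r A 0 ^ n * det ?A1 = r A 0 * det (mat n n (\<lambda>(i, j). r A 0 * A $$ (1 + i, 1 + j) - W A i j))"
        using det_schur_complement[of ?K 1 ?Y n ?X ?C "1\<^sub>m 1" "r A 0"] by simp
    qed
    finally show ?thesis .
  qed
  then have "{A \<in> S. \<not> int ?m dvd det A} = {A \<in> S. \<not> int ?d dvd
      det (mat n n (\<lambda>(i, j). r A 0 * A $$ (1 + i, 1 + j) - W A i j))}"
    by blast
  moreover have "real (card {A \<in> S. \<not> int ?d dvd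
      det (mat n n (\<lambda>(i, j). r A 0 * A $$ (1 + i, 1 + j) - W A i j))}) = real (card S) * prob_nonsing n ?d"
  proof (rule prob_lower_block[where m = ?m])
    show "?d dvd ?m" by (simp add: m)
    show "W A i j = W A j i" for A i j by (simp add: W_def)
  qed (use unit p0 in \<open>auto simp: S_def rows_agree_def r_def W_def\<close>)
  ultimately show ?thesis by simp
qed

text \<open>Row 0 and column 0 can both be divided by \<open>p\<close>, which costs the determinant
  a factor \<open>p\<^sup>2\<close>. The entry \<open>(i, j)\<close> of the quotient
  \<open>\<Psi> A\<close> is uniform modulo \<open>p ^ e / c i j\<close>, a multiple of
  \<open>p ^ (e - 2)\<close>; the shifts by \<open>c i j * t\<close> make this precise.\<close>

lemma prob_row_multiple_double_corner:
  fixes N e :: nat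
  assumes e: "e \<ge> 2" and N: "N > 0"
  defines "S \<equiv> {A \<in> sym_mats N (p ^ e). (\<forall>j<N. int p dvd A $$ (0, j)) \<and> int p ^ 2 dvd A $$ (0, 0)}"
  shows "real (card {A \<in> S. \<not> int (p ^ e) dvd det A}) = real (card S) * prob_nonsing N (p ^ (e - 2))"
proof -
  let ?m = "p ^ e" and ?d = "p ^ (e - 2)"
  define s where "s i = (if i = (0::nat) then int p else 1)" for i
  define c where "c i j = s i * s j" for i j
  define \<Psi> where "\<Psi> A = mat N N (\<lambda>(i, j). A $$ (i, j) div c i j)" for A :: "int mat"
  have p0: "p > 0" using p by (rule prime_gt_0_nat)
  have c_pos: "c i j > 0" for i j using p0 by (simp add: c_def s_def)
  have c_sym: "c i j = c j i" for i j by (simp add: c_def)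
  have m: "?m = p\<^sup>2 * ?d" using e by (metis le_add_diff_inverse power_add)
  have c_dvd: "c i j dvd (int p)\<^sup>2" for i j by (auto simp: c_def s_def power2_eq_square)
  have dvd_iff: "(\<forall>i<N. \<forall>j<N. c i j dvd A $$ (i, j)) \<longleftrightarrow>
      (\<forall>j<N. int p dvd A $$ (0, j)) \<and> int p ^ 2 dvd A $$ (0, 0)" if "A \<in> sym_mats N ?m" for A
  proof
    assume L: "\<forall>i<N. \<forall>j<N. c i j dvd A $$ (i, j)"
    have "int p dvd A $$ (0, j)" if "j < N" for j
    proof (rule dvd_trans)
      show "int p dvd c 0 j" by (simp add: c_def s_def)
      show "c 0 j dvd A $$ (0, j)" using L N that by blast
    qed
    moreover have "c 0 0 dvd A $$ (0, 0)" using L N by blast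
    ultimately show "(\<forall>j<N. int p dvd A $$ (0, j)) \<and> int p ^ 2 dvd A $$ (0, 0)"
      by (simp add: c_def s_def power2_eq_square)
  next
    assume R: "(\<forall>j<N. int p dvd A $$ (0, j)) \<and> int p ^ 2 dvd A $$ (0, 0)"
    show "\<forall>i<N. \<forall>j<N. c i j dvd A $$ (i, j)"
    proof (intro allI impI)
      fix i j assume ij: "i < N" "j < N"
      have "int p dvd A $$ (i, 0)" using R ij sym_mats_index(1)[OF that ij(1) N] by simp
      then show "c i j dvd A $$ (i, j)"
        using R ij by (cases "i = 0"; cases "j = 0") (simp_all add: c_def s_def power2_eq_square)
    qed
  qed
  have S_alt: "S = {A \<in> sym_mats N ?m. \<forall>i<N. \<forall>j<N. c i j dvd A $$ (i, j)}"
    using dvd_iff by (auto simp: S_def)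
  have "int ?m dvd det A \<longleftrightarrow> int ?d dvd det (\<Psi> A)" if A: "A \<in> S" for A
  proof -
    have "A = mat N N (\<lambda>(i, j). s i * s j * \<Psi> A $$ (i, j))"
      using A sym_mats_carrier[of A N ?m] by (intro eq_matI) (auto simp: S_alt \<Psi>_def c_def)
    moreover have "(\<Prod>i<N. s i) = int p" using N by (simp add: s_def prod.delta)
    moreover have "\<Psi> A \<in> carrier_mat N N" by (simp add: \<Psi>_def)
    ultimately have "det A = int p * int p * det (\<Psi> A)"
      using det_scale_rows_cols[of "\<Psi> A" N s s] by simp
    then show ?thesis unfolding m using p0 by (simp add: power2_eq_square)
  qed
  then have "{A \<in> S. \<not> int ?m dvd det A} = {A \<in> S. \<not> int ?d dvd det (\<Psi> A)}" by blast
  moreover have "real (card {A \<in> S. \<not> int ?d dvd det (\<Psi> A)}) = real (card S) * prob_nonsing N ?d"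
  proof (rule prob_by_shift_equivariance[where u = "\<lambda>_. 1" and m = ?m and E = "\<lambda>t i j. c i j * t $$ (i, j)"])
    fix A t assume A: "A \<in> S" and t: "t \<in> sym_mats N ?d"
    let ?R = "radd N ?m A (\<lambda>i j. c i j * t $$ (i, j))"
    \<comment> \<open>Since \<open>c i j\<close> divides \<open>p ^ e\<close>, it can be pulled out
      of the reduction modulo \<open>p ^ e\<close>, leaving the modulus
      \<open>p ^ e / c i j\<close>.\<close>
    have R: "?R $$ (i, j) = c i j * ((\<Psi> A $$ (i, j) + t $$ (i, j)) mod ((int p)\<^sup>2 div c i j * int ?d))"
      if ij: "i < N" "j < N" for i j
    proof -
      have "int ?m = c i j * ((int p)\<^sup>2 div c i j * int ?d)"
        using c_dvd[of i j] by (simp add: m flip: mult.assoc)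
      moreover have "A $$ (i, j) = c i j * \<Psi> A $$ (i, j)"
        using A ij by (simp add: S_alt \<Psi>_def)
      ultimately show ?thesis
        using ij by (simp only: radd_index mult_mod_right distrib_left)
    qed
    show "?R \<in> S"
      unfolding S_alt
    proof (intro CollectI conjI allI impI radd_sym_mats)
      show "A \<in> sym_mats N ?m" using A by (simp add: S_def)
      show "c i j * t $$ (i, j) = c j i * t $$ (j, i)" if "i < N" "j < N" for i j
        using sym_mats_index(1)[OF t that] by (simp add: c_sym)
    qed (use R p0 in simp_all)
    show "[\<Psi> ?R $$ (i, j) = \<Psi> A $$ (i, j) + 1 * t $$ (i, j)] (mod int ?d)" if ij: "i < N" "j < N" for i j
    proof -
      have "\<Psi> ?R $$ (i, j) = (\<Psi> A $$ (i, j) + t $$ (i, j)) mod ((int p)\<^sup>2 div c i j * int ?d)"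
        using ij R[OF ij] c_pos[of i j] by (simp add: \<Psi>_def del: radd_index)
      then have "[\<Psi> ?R $$ (i, j) = \<Psi> A $$ (i, j) + t $$ (i, j)] (mod ((int p)\<^sup>2 div c i j * int ?d))"
        by (simp only: cong_def mod_mod_trivial)
      then have "[\<Psi> ?R $$ (i, j) = \<Psi> A $$ (i, j) + t $$ (i, j)] (mod int ?d)"
        by (rule cong_dvd_modulus) simp
      then show ?thesis by (simp only: mult_1)
    qed
  next
    fix A i j assume A: "A \<in> S" and ij: "i < N" "j < N"
    then show "\<Psi> A $$ (i, j) = \<Psi> A $$ (j, i)"
      using sym_mats_index(1)[of A N ?m i j] by (simp add: \<Psi>_def S_def c_sym)
  qed (use p0 in \<open>auto simp: S_def \<Psi>_def\<close>)
  ultimately show ?thesis by simp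
qed

end

section \<open>The recurrences\<close>

text \<open>The set \<open>T j\<close> collects the matrices whose first unit in row 0 stands at
  position \<open>j\<close>, and \<open>U N\<close> those with no unit in row 0. For
  \<open>N = 1\<close> the truncated \<open>N - 2\<close> does no harm, because its coefficient
  \<open>q - q ^ N\<close> is 0.\<close>

lemma prob_nonsing_recurrence:
  assumes p: "prime p" and e: "e > 0" and N: "N > 0"
  defines "q \<equiv> 1 / real p"
  shows "prob_nonsing N (p ^ e) = (1 - q) * prob_nonsing (N - 1) (p ^ e)
      + (q - q ^ N) * prob_nonsing (N - 2) (p ^ e)
      + (if e \<ge> 2 then q ^ N * ((1 - q) * prob_nonsing (N - 1) (p ^ (e - 1))
           + q * prob_nonsing N (p ^ (e - 2))) else 0)"
proof -
  let ?m = "p ^ e"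
  define c where "c = real (card (sym_mats N ?m))"
  define U where "U j = {A \<in> sym_mats N ?m. \<forall>i<j. int p dvd A $$ (0, i)}" for j
  define T where "T j = {A \<in> sym_mats N ?m. (\<forall>i<j. int p dvd A $$ (0, i)) \<and> \<not> int p dvd A $$ (0, j)}" for j
  define good where "good X = real (card {A \<in> X. \<not> int ?m dvd det A})" for X
  have p0: "p > 0" using p by (rule prime_gt_0_nat)
  have m0: "?m > 0" using p0 by simp
  have c0: "c > 0" unfolding c_def using card_sym_mats_pos[OF m0] by simp
  have fin: "finite X" if "X \<subseteq> sym_mats N ?m" for X
    using that finite_sym_mats by (rule finite_subset)
  have Un: "U j = T j \<union> U (Suc j)" and disj: "T j \<inter> U (Suc j) = {}" for j
    by (auto simp: U_def T_def less_Suc_eq)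
  have sub: "U j \<subseteq> sym_mats N ?m" "T j \<subseteq> sym_mats N ?m" for j by (auto simp: U_def T_def)
  have good_Un: "good (X \<union> Y) = good X + good Y" if "X \<inter> Y = {}" "X \<subseteq> sym_mats N ?m" "Y \<subseteq> sym_mats N ?m" for X Y
  proof -
    have "{A \<in> X \<union> Y. \<not> int ?m dvd det A} = {A \<in> X. \<not> int ?m dvd det A} \<union> {A \<in> Y. \<not> int ?m dvd det A}" by auto
    moreover have "{A \<in> X. \<not> int ?m dvd det A} \<inter> {A \<in> Y. \<not> int ?m dvd det A} = {}" using that(1) by auto
    ultimately show ?thesis
      unfolding good_def using fin[OF that(2)] fin[OF that(3)] by (simp add: card_Un_disjoint)
  qed
  have card_U: "real (card (U j)) = c * q ^ j" if "j \<le> N" for j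
  proof -
    have "U j = {A \<in> sym_mats N ?m. \<forall>i<N. int (if i < j then p else 1) dvd A $$ (0, i)}"
      using that by (auto simp: U_def)
    then have "real (card (U j)) = c * (\<Prod>i<N. 1 / real (if i < j then p else 1))"
      using card_sym_mats_row_multiples[OF N m0, of "\<lambda>i. if i < j then p else 1"] e
      by (simp add: c_def)
    also have "(\<Prod>i<N. 1 / real (if i < j then p else 1)) = (\<Prod>i<j. q)"
      using that by (intro prod.mono_neutral_cong_right) (auto simp: q_def)
    finally show ?thesis by simp
  qed
  have card_T: "real (card (T j)) = c * (q ^ j - q ^ Suc j)" if "j < N" for j
    using card_Un_disjoint[OF fin[OF sub(2)] fin[OF sub(1)] disj, of j] card_U[of j] card_U[of "Suc j"] that
    by (simp flip: Un add: algebra_simps)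
  have good_T: "good (T j) = c * (q ^ j - q ^ Suc j) * prob_nonsing (if j = 0 then N - 1 else N - 2) ?m"
    if j: "j < N" for j
  proof (cases "j = 0")
    case True
    have "1 + (N - 1) = N" using N by simp
    then show ?thesis
      using prob_unit_corner[OF p e, of "N - 1"] card_T[OF j] True by (simp add: good_def T_def)
  next
    case False
    then have "2 + (N - 2) = N" using j by simp
    then show ?thesis
      using prob_unit_off_diagonal[OF p e, of j "N - 2"] card_T[OF j] False j by (simp add: good_def T_def)
  qed
  have good_split: "good (U 0) = (\<Sum>j<k. good (T j)) + good (U k)" for k
  proof (induction k)
    case (Suc k)
    then show ?case using good_Un[OF disj sub(2) sub(1), of k] by (simp flip: Un)
  qed simp
  have good_UN: "good (U N) = (if e \<ge> 2 then c * (q ^ N * ((1 - q) * prob_nonsing (N - 1) (p ^ (e - 1))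
           + q * prob_nonsing N (p ^ (e - 2)))) else 0)"
  proof (cases "e \<ge> 2")
    case False
    then have "e = 1" using e by simp
    \<comment> \<open>For \<open>e = 1\<close> the whole row 0 vanishes modulo \<open>p ^ e\<close>,
      so \<open>U N\<close> contributes nothing.\<close>
    have "int ?m dvd det A" if "A \<in> U N" for A
    proof -
      have "A \<in> carrier_mat N N" using that sym_mats_carrier by (auto simp: U_def)
      then have "det A = (\<Sum>j<N. A $$ (0, j) * cofactor A 0 j)"
        using N by (rule laplace_expansion_row)
      then show ?thesis using that \<open>e = 1\<close> by (auto simp: U_def intro!: dvd_sum)
    qed
    then have "{A \<in> U N. \<not> int ?m dvd det A} = {}" by auto
    then show ?thesis using False by (simp only: good_def if_False) simp
  next
    case True
    define V where "V = {A \<in> sym_mats N ?m. (\<forall>j<N. int p dvd A $$ (0, j)) \<and> int p ^ 2 dvd A $$ (0, 0)}"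
    define V' where "V' = {A \<in> sym_mats N ?m. (\<forall>j<N. int p dvd A $$ (0, j)) \<and> \<not> int p ^ 2 dvd A $$ (0, 0)}"
    have UV: "U N = V' \<union> V" "V' \<inter> V = {}" and subV: "V \<subseteq> sym_mats N ?m" "V' \<subseteq> sym_mats N ?m"
      by (auto simp: U_def V_def V'_def)
    have "V = {A \<in> sym_mats N ?m. \<forall>i<N. int (if i = 0 then p\<^sup>2 else p) dvd A $$ (0, i)}"
    proof -
      have "int p dvd x" if "(int p)\<^sup>2 dvd x" for x using that by (auto simp: power2_eq_square elim: dvd_mult_left)
      then show ?thesis using N by (auto simp: V_def)
    qed
    \<comment> \<open>The corner contributes \<open>q\<^sup>2\<close> and each of the other
      \<open>N - 1\<close> entries contributes \<open>q\<close>.\<close>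
    moreover have "(\<Prod>i<N. 1 / real (if i = 0 then p\<^sup>2 else p)) = q ^ Suc N"
      using N by (cases N) (simp_all only: prod.lessThan_Suc_shift, simp_all add: q_def power2_eq_square power_divide)
    moreover have "(if i = 0 then p\<^sup>2 else p) dvd ?m" for i :: nat
      using True by (simp add: le_imp_power_dvd)
    ultimately have card_V: "real (card V) = c * q ^ Suc N"
      using card_sym_mats_row_multiples[OF N m0, of "\<lambda>i. if i = 0 then p\<^sup>2 else p"] by (simp add: c_def)
    then have card_V': "real (card V') = c * (q ^ N - q ^ Suc N)"
      using card_Un_disjoint[OF fin[OF subV(2)] fin[OF subV(1)] UV(2)] card_U[of N]
      by (simp flip: UV(1) add: algebra_simps)
    have "good V = c * q ^ Suc N * prob_nonsing N (p ^ (e - 2))"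
      using prob_row_multiple_double_corner[OF p True N] card_V by (simp add: good_def V_def)
    moreover have "good V' = c * (q ^ N - q ^ Suc N) * prob_nonsing (N - 1) (p ^ (e - 1))"
      using prob_row_multiple_simple_corner[OF p True, of "N - 1"] card_V' N by (simp add: good_def V'_def)
    ultimately show ?thesis
      using good_Un[OF UV(2) subV(2) subV(1)] True by (simp add: UV(1) algebra_simps)
  qed
  obtain M where M: "N = Suc M" using N by (cases N) auto
  have "(\<Sum>j<N. good (T j)) = good (T 0) + (\<Sum>j<M. good (T (Suc j)))"
    unfolding M by (rule sum.lessThan_Suc_shift)
  also have "(\<Sum>j<M. good (T (Suc j))) = (\<Sum>j<M. (q ^ Suc j - q ^ Suc (Suc j)) * (c * prob_nonsing (N - 2) ?m))"
    by (intro sum.cong refl) (simp add: good_T M)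
  \<comment> \<open>All positions \<open>j > 0\<close> lead to the same size \<open>N - 2\<close>,
    so their probabilities telescope.\<close>
  also have "\<dots> = (q - q ^ N) * (c * prob_nonsing (N - 2) ?m)"
    unfolding sum_distrib_right[symmetric] sum_lessThan_telescope'[of "\<lambda>j. q ^ Suc j"] by (simp add: M)
  also have "good (T 0) = c * ((1 - q) * prob_nonsing (N - 1) ?m)"
    using good_T[OF N] by simp
  finally have "good (U 0) = c * ((1 - q) * prob_nonsing (N - 1) ?m) + (q - q ^ N) * (c * prob_nonsing (N - 2) ?m) + good (U N)"
    using good_split[of N] by simp
  moreover have "good (U 0) = c * prob_nonsing N ?m"
    using c0 by (simp add: good_def U_def c_def prob_nonsing_def)
  ultimately have "c * prob_nonsing N ?m = c * ((1 - q) * prob_nonsing (N - 1) ?m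
      + (q - q ^ N) * prob_nonsing (N - 2) ?m
      + (if e \<ge> 2 then q ^ N * ((1 - q) * prob_nonsing (N - 1) (p ^ (e - 1))
           + q * prob_nonsing N (p ^ (e - 2))) else 0))"
    unfolding good_UN by (simp add: algebra_simps)
  then show ?thesis using c0 by (simp only: mult_cancel_left) simp
qed

text \<open>The empty determinant is 1, so the boundary value of \<open>P\<close> at size 0 agrees
  with the counting definition.\<close>

lemma prob_nonsing_0: "m > 1 \<Longrightarrow> prob_nonsing 0 m = 1"
proof -
  assume m: "m > 1"
  have "\<not> int m dvd det A" if "A \<in> sym_mats 0 m" for A
    using sym_mats_carrier[OF that] m by (simp add: det_dim_zero zdvd1_eq)
  then have "{A \<in> sym_mats 0 m. \<not> int m dvd det A} = sym_mats 0 m" by auto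
  then show ?thesis using card_sym_mats_pos[of m 0] m by (simp add: prob_nonsing_def)
qed

lemma P_eq_prob_nonsing: "prime p \<Longrightarrow> \<mu> > 0 \<Longrightarrow> P p n \<mu> = prob_nonsing n (p ^ nat \<mu>)"
  by (cases "n = 0") (auto simp: P_def dest: prime_gt_1_nat intro!: prob_nonsing_0 one_less_power)

text \<open>The zero boundary values absorb the case distinction on the exponent, so the recurrence
  holds for every integer \<open>\<mu>\<close> and can be treated with shift operators.\<close>

lemma P_recurrence:
  assumes p: "prime p" and n: "n > 0"
  defines "q \<equiv> 1 / real p"
  shows "P p n \<mu> = (1 - q) * P p (n - 1) \<mu> + (q - q ^ n) * P p (n - 2) \<mu>
      + q ^ n * ((1 - q) * P p (n - 1) (\<mu> - 1) + q * P p n (\<mu> - 2))"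
proof (cases "\<mu> > 0")
  case False
  then show ?thesis by (simp add: P_def)
next
  case True
  \<comment> \<open>Modulus 1 divides every determinant, so at \<open>\<mu> = 2\<close> the counted
    term equals the boundary value at exponent 0.\<close>
  have "prob_nonsing k 1 = 0" for k by (simp add: prob_nonsing_def)
  then have "P p n (\<mu> - 2) = prob_nonsing n (p ^ (nat \<mu> - 2))" if "\<mu> \<ge> 2"
    using P_eq_prob_nonsing[OF p, of "\<mu> - 2" n] that
    by (cases "\<mu> = 2") (auto simp: P_def nat_diff_distrib)
  moreover have "P p (n - 1) (\<mu> - 1) = prob_nonsing (n - 1) (p ^ (nat \<mu> - 1))" if "\<mu> \<ge> 2"
    using P_eq_prob_nonsing[OF p, of "\<mu> - 1" "n - 1"] that by (simp add: nat_diff_distrib)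
  moreover have "P p n (\<mu> - 2) = 0" "P p (n - 1) (\<mu> - 1) = 0" if "\<not> \<mu> \<ge> 2"
    using that by (simp_all add: P_def)
  ultimately show ?thesis
    using prob_nonsing_recurrence[OF p, of "nat \<mu>" n] True n P_eq_prob_nonsing[OF p True]
    by (cases "\<mu> \<ge> 2") (simp_all add: q_def nat_le_iff le_nat_iff)
qed

section \<open>Solving the recurrence\<close>

text \<open>Repeated steps down by \<open>k\<close> reach the region where \<open>g\<close>
  vanishes. In operator terms, \<open>1 - a T ^ k\<close> is injective on functions that vanish at
  all non-positive arguments.\<close>

lemma vanishing_by_recursion:
  fixes g :: "int \<Rightarrow> real"
  assumes g: "\<And>\<mu>. \<mu> \<le> 0 \<Longrightarrow> g \<mu> = 0" and rec: "\<And>\<mu>. g \<mu> = a * g (\<mu> - k)" and k: "k > 0"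
  shows "g \<mu> = 0"
proof (induction "nat \<mu>" arbitrary: \<mu> rule: less_induct)
  case less
  show ?case
  proof (cases "\<mu> \<le> 0")
    case False
    then have "g (\<mu> - k) = 0" using k by (intro less) auto
    then show ?thesis using rec[of \<mu>] by simp
  qed (rule g)
qed

text \<open>With the shift \<open>(T f) \<mu> = f (\<mu> - 1)\<close> and \<open>y = q ^ n\<close>, the hypotheses read
  \<open>(1 - q y T\<^sup>2) f\<^sub>n = (1 - q) (1 + y T) f\<^sub>n\<^sub>-\<^sub>1 + (q - y) f\<^sub>n\<^sub>-\<^sub>2\<close> and
  \<open>(1 - y T\<^sup>2) f\<^sub>n\<^sub>-\<^sub>1 = (1 - y T) f\<^sub>n\<^sub>-\<^sub>2\<close>. The defects \<open>b = (1 - y T) f\<^sub>n - (1 - y) f\<^sub>n\<^sub>-\<^sub>1\<close> and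
  \<open>a = (1 - y T\<^sup>2) f\<^sub>n - (1 - y) f\<^sub>n\<^sub>-\<^sub>2\<close> then satisfy \<open>(1 - q) (1 + y T) b + (q - y) a = 0\<close> and
  \<open>(1 - y T\<^sup>2) b = (1 - y T) a\<close>, so \<open>(1 - y) (1 - q y T\<^sup>2) b = 0\<close>.\<close>
lemma odd_step:
  fixes f g h :: "int \<Rightarrow> real"
  assumes zero: "\<And>\<mu>. \<mu> \<le> 0 \<Longrightarrow> f \<mu> = 0 \<and> g \<mu> = 0 \<and> h \<mu> = 0"
    and rec: "\<And>\<mu>. f \<mu> = (1 - q) * g \<mu> + (q - y) * h \<mu> + y * ((1 - q) * g (\<mu> - 1) + q * f (\<mu> - 2))"
    and gh: "\<And>\<mu>. g \<mu> - y * g (\<mu> - 2) = h \<mu> - y * h (\<mu> - 1)"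
    and y: "y \<noteq> 1" "y \<noteq> q"
  shows "(1 - y) * g \<mu> = f \<mu> - y * f (\<mu> - 1)" and "f \<mu> = (1 - y) * h \<mu> + y * f (\<mu> - 2)"
proof -
  define b where "b \<mu> = f \<mu> - y * f (\<mu> - 1) - (1 - y) * g \<mu>" for \<mu>
  define a where "a \<mu> = f \<mu> - y * f (\<mu> - 2) - (1 - y) * h \<mu>" for \<mu>
  have R1: "(1 - q) * (b \<mu> + y * b (\<mu> - 1)) + (q - y) * a \<mu> = 0" for \<mu>
  proof -
    have "(1 - q) * (b \<mu> + y * b (\<mu> - 1)) + (q - y) * a \<mu>
        = (1 - y) * (f \<mu> - ((1 - q) * g \<mu> + (q - y) * h \<mu> + y * ((1 - q) * g (\<mu> - 1) + q * f (\<mu> - 2))))"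
      by (simp add: b_def a_def algebra_simps)
    then show ?thesis using rec[of \<mu>] by simp
  qed
  have R2: "b \<mu> - y * b (\<mu> - 2) = a \<mu> - y * a (\<mu> - 1)" for \<mu>
  proof -
    have "b \<mu> - y * b (\<mu> - 2) - (a \<mu> - y * a (\<mu> - 1))
        = (1 - y) * ((h \<mu> - y * h (\<mu> - 1)) - (g \<mu> - y * g (\<mu> - 2)))"
      by (simp add: b_def a_def algebra_simps)
    then show ?thesis using gh[of \<mu>] by simp
  qed
  \<comment> \<open>Apply \<open>1 - y T\<close> to \<open>R1\<close> and use \<open>R2\<close> to
    trade \<open>(1 - y T) a\<close> for \<open>(1 - y T\<^sup>2) b\<close>. The coefficient
    \<open>y\<^sup>2 (1 - q) + y (q - y)\<close> of \<open>T\<^sup>2 b\<close> is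
    \<open>q y (1 - y)\<close>, so \<open>1 - y\<close> factors out.\<close>
  have R3: "(1 - y) * (b \<mu> - q * y * b (\<mu> - 2)) = 0" for \<mu>
  proof -
    have "(1 - y) * (b \<mu> - q * y * b (\<mu> - 2))
        = ((1 - q) * (b \<mu> + y * b (\<mu> - 1)) + (q - y) * a \<mu>)
          - y * ((1 - q) * (b (\<mu> - 1) + y * b (\<mu> - 1 - 1)) + (q - y) * a (\<mu> - 1))
          + (q - y) * ((b \<mu> - y * b (\<mu> - 2)) - (a \<mu> - y * a (\<mu> - 1)))"
      by (simp add: algebra_simps)
    then show ?thesis by (simp only: R1 R2) simp
  qed
  have "b \<mu> = q * y * b (\<mu> - 2)" for \<mu> using R3[of \<mu>] y by simp
  then have b: "b \<mu> = 0" for \<mu>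
    by (rule vanishing_by_recursion[rotated]) (auto simp: b_def zero)
  then have "a \<mu> = 0" using R1[of \<mu>] y by simp
  then show "f \<mu> = (1 - y) * h \<mu> + y * f (\<mu> - 2)" by (simp add: a_def)
  show "(1 - y) * g \<mu> = f \<mu> - y * f (\<mu> - 1)" using b[of \<mu>] by (simp add: b_def)
qed

text \<open>Induction on \<open>k\<close> for the first identity: at \<open>2 * k + 1\<close> it
  turns the recurrence of even index \<open>2 * k + 2\<close> into the hypothesis \<open>gh\<close>
  of \<open>odd_step\<close>, which then yields both identities at \<open>2 * k + 3\<close>.\<close>

lemma recurrence_solution:
  fixes f :: "nat \<Rightarrow> int \<Rightarrow> real"
  assumes q: "0 < q" "q < 1" and zero: "\<And>n \<mu>. \<mu> \<le> 0 \<Longrightarrow> f n \<mu> = 0"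
    and rec: "\<And>n \<mu>. n > 0 \<Longrightarrow> f n \<mu> = (1 - q) * f (n - 1) \<mu> + (q - q ^ n) * f (n - 2) \<mu>
      + q ^ n * ((1 - q) * f (n - 1) (\<mu> - 1) + q * f n (\<mu> - 2))"
  shows "(1 - q ^ (2 * k + 1)) * f (2 * k) \<mu> = f (2 * k + 1) \<mu> - q ^ (2 * k + 1) * f (2 * k + 1) (\<mu> - 1)"
    and "f (2 * k + 3) \<mu> = (1 - q ^ (2 * k + 3)) * f (2 * k + 1) \<mu> + q ^ (2 * k + 3) * f (2 * k + 3) (\<mu> - 2)"
proof -
  have step: "(1 - q ^ (2 * k + 3)) * f (2 * k + 2) \<mu> = f (2 * k + 3) \<mu> - q ^ (2 * k + 3) * f (2 * k + 3) (\<mu> - 1)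
      \<and> f (2 * k + 3) \<mu> = (1 - q ^ (2 * k + 3)) * f (2 * k + 1) \<mu> + q ^ (2 * k + 3) * f (2 * k + 3) (\<mu> - 2)"
    if IH: "\<And>\<mu>. (1 - q ^ (2 * k + 1)) * f (2 * k) \<mu> = f (2 * k + 1) \<mu> - q ^ (2 * k + 1) * f (2 * k + 1) (\<mu> - 1)"
    for k \<mu>
  proof -
    define x where "x = q ^ (2 * k + 1)"
    have pow: "q ^ (2 * k + 2) = q * x" "q ^ (2 * k + 3) = q * (q * x)"
      by (simp_all add: x_def numeral_3_eq_3)
    have "x < 1" "x > 0" using q by (simp_all add: x_def power_Suc_less_one del: power_Suc)
    then have y: "q * (q * x) \<noteq> 1" "q * (q * x) \<noteq> q"
      using q mult_strict_mono[of q 1 x 1] mult_strict_mono[of q 1 "q * x" 1] by auto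
    have gh: "f (2 * k + 2) \<mu> - q * (q * x) * f (2 * k + 2) (\<mu> - 2)
        = f (2 * k + 1) \<mu> - q * (q * x) * f (2 * k + 1) (\<mu> - 1)" for \<mu>
    proof -
      \<comment> \<open>The coefficient \<open>q - q ^ (2 * k + 2)\<close> is
        \<open>q (1 - x)\<close>, exactly what the induction hypothesis can rewrite; this eliminates
        \<open>f (2 * k)\<close>.\<close>
      have "(q - q * x) * f (2 * k) \<mu> = q * (f (2 * k + 1) \<mu> - x * f (2 * k + 1) (\<mu> - 1))"
        by (simp only: IH[of \<mu>, folded x_def, symmetric]) (simp add: algebra_simps)
      moreover have "f (2 * k + 2) \<mu> = (1 - q) * f (2 * k + 1) \<mu> + (q - q * x) * f (2 * k) \<mu>
          + q * x * ((1 - q) * f (2 * k + 1) (\<mu> - 1) + q * f (2 * k + 2) (\<mu> - 2))"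
        using rec[of "2 * k + 2" \<mu>] by (simp only: pow) simp
      ultimately show ?thesis by (simp add: algebra_simps)
    qed
    have rec': "f (2 * k + 3) \<mu> = (1 - q) * f (2 * k + 2) \<mu> + (q - q * (q * x)) * f (2 * k + 1) \<mu>
          + q * (q * x) * ((1 - q) * f (2 * k + 2) (\<mu> - 1) + q * f (2 * k + 3) (\<mu> - 2))" for \<mu>
    proof -
      have "2 * k + 3 - 1 = 2 * k + 2" "2 * k + 3 - 2 = 2 * k + 1" by simp_all
      then show ?thesis using rec[of "2 * k + 3" \<mu>] by (simp only: pow)
    qed
    show ?thesis
      unfolding pow using odd_step[OF _ rec' gh y, of \<mu>] zero by blast
  qed
  have down: "(1 - q ^ (2 * k + 1)) * f (2 * k) \<mu> = f (2 * k + 1) \<mu> - q ^ (2 * k + 1) * f (2 * k + 1) (\<mu> - 1)" for k \<mu>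
  proof (induction k arbitrary: \<mu>)
    case 0
    \<comment> \<open>At \<open>n = 1\<close> the coefficient \<open>q - q ^ n\<close> is 0, and the
      recurrence reads \<open>(1 - q\<^sup>2 T\<^sup>2) f 1 = (1 - q) (1 + q T) f 0\<close>. Hence
      \<open>1 + q T\<close> annihilates the defect \<open>b\<close>.\<close>
    define b where "b \<mu> = f 1 \<mu> - q * f 1 (\<mu> - 1) - (1 - q) * f 0 \<mu>" for \<mu>
    have "b \<mu> = - q * b (\<mu> - 1)" for \<mu>
      using rec[of 1 \<mu>] by (simp add: b_def algebra_simps)
    then have "b \<mu> = 0" for \<mu>
      by (rule vanishing_by_recursion[rotated]) (auto simp: b_def zero)
    then show ?case by (simp add: b_def algebra_simps)
  next
    case (Suc k)
    have "2 * Suc k + 1 = 2 * k + 3" "2 * Suc k = 2 * k + 2" by simp_all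
    then show ?case using step[OF Suc, of \<mu>] by metis
  qed
  then show "(1 - q ^ (2 * k + 1)) * f (2 * k) \<mu> = f (2 * k + 1) \<mu> - q ^ (2 * k + 1) * f (2 * k + 1) (\<mu> - 1)" .
  show "f (2 * k + 3) \<mu> = (1 - q ^ (2 * k + 3)) * f (2 * k + 1) \<mu> + q ^ (2 * k + 3) * f (2 * k + 3) (\<mu> - 2)"
    using step[OF down] by blast
qed

theorem theorem4p1:
  fixes p :: nat and \<mu> :: int
  assumes "prime p" and "\<mu> > 0"
  shows "(\<forall>n::nat. odd n \<and> n \<ge> 3 \<longrightarrow>
            P p n \<mu> = (1 - (1 / real p) ^ n) * P p (n - 2) \<mu> + (1 / real p) ^ n * P p n (\<mu> - 2))
       \<and> (\<forall>n::nat. odd n \<and> n \<ge> 1 \<longrightarrow>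
            P p (n - 1) \<mu> = (P p n \<mu> - (1 / real p) ^ n * P p n (\<mu> - 1)) / (1 - (1 / real p) ^ n))"
proof (intro conjI allI impI)
  define q where "q = 1 / real p"
  have q: "0 < q" "q < 1" using prime_gt_1_nat[OF assms(1)] by (simp_all add: q_def)
  note sol = recurrence_solution[of q "P p", OF q _ P_recurrence[OF assms(1), folded q_def]]
  have zero: "P p n \<mu> = 0" if "\<mu> \<le> 0" for n \<mu> using that by (simp add: P_def)
  fix n :: nat
  {
    assume "odd n \<and> n \<ge> 3"
    then obtain k where "n = 2 * k + 3"
      by (metis add.commute add_2_eq_Suc' le_Suc_ex oddE odd_add odd_numeral even_mult_iff dvd_def)
    then show "P p n \<mu> = (1 - (1 / real p) ^ n) * P p (n - 2) \<mu> + (1 / real p) ^ n * P p n (\<mu> - 2)"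
      using sol(2)[OF zero, of k \<mu>] by (simp add: q_def)
  next
    assume "odd n \<and> n \<ge> 1"
    then obtain k where n: "n = 2 * k + 1" by (auto elim: oddE)
    have "q ^ n < 1" using q by (simp add: n power_Suc_less_one del: power_Suc)
    then show "P p (n - 1) \<mu> = (P p n \<mu> - (1 / real p) ^ n * P p n (\<mu> - 1)) / (1 - (1 / real p) ^ n)"
      using sol(1)[OF zero, of k \<mu>]
      by (simp add: nonzero_eq_divide_eq mult.commute n flip: q_def)
  }
qed

end
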